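(* There is a constant $c$ such that every graph with separation dimension $3$ has average degree at most $c$.
   Context: For a graph $G$, a function $f:V(G)\to\mathbb{R}^d$ is separating if for all pairs of disjoint edges $vw,xy\in E(G)$ there is an axis-parallel hyperplane separating the point pair $\{f(v),f(w)\}$ from $\{f(x),f(y)\}$. The separation dimension of $G$ is the minimum positive integer $d$ for which $G$ has a separating function into $\mathbb{R}^d$. Equivalently, it is the minimum number of linear orderings of $V(G)$ such that for every pair of disjoint edges $e,f$, in at least one ordering both endpoints of $e$ precede both endpoints of $f$ or both endpoints of $f$ precede both endpoints of $e$. *)

theory Defs
  imports Complex_Main
begin

definition finite_simple_graph :: "'a set \<Rightarrow> 'a set set \<Rightarrow> bool" where
  "finite_simple_graph V E \<longleftrightarrow> finite V \<and> (\<forall>e\<in>E. e \<subseteq> V \<and> card e = 2)"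

definition degree :: "'a set set \<Rightarrow> 'a \<Rightarrow> nat" where
  "degree E v = card {e \<in> E. v \<in> e}"

definition average_degree :: "'a set \<Rightarrow> 'a set set \<Rightarrow> real" where
  "average_degree V E = (\<Sum>v\<in>V. real (degree E v)) / real (card V)"

text \<open>
  Since the dimension d has to vary inside a formula, a point of d-dimensional real space is a
  function from the coordinates below d to the reals; values at other arguments are irrelevant.
  The hyperplane of all x with \<open>x i = a\<close> separates two sets of points if they lie in different
  open half-spaces. With closed half-spaces a constant function would be separating.
\<close>

definition hyperplane_separates ::
    "nat \<Rightarrow> real \<Rightarrow> (nat \<Rightarrow> real) set \<Rightarrow> (nat \<Rightarrow> real) set \<Rightarrow> bool" where
  "hyperplane_separates i a P Q \<longleftrightarrow>
     (\<forall>p\<in>P. p i < a) \<and> (\<forall>q\<in>Q. a < q i) \<or>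
     (\<forall>p\<in>P. a < p i) \<and> (\<forall>q\<in>Q. q i < a)"

definition separating_function :: "'a set set \<Rightarrow> nat \<Rightarrow> ('a \<Rightarrow> nat \<Rightarrow> real) \<Rightarrow> bool" where
  "separating_function E d f \<longleftrightarrow>
     (\<forall>e\<in>E. \<forall>e'\<in>E. e \<inter> e' = {} \<longrightarrow> (\<exists>i<d. \<exists>a. hyperplane_separates i a (f ` e) (f ` e')))"

text \<open>Isolated vertices impose no condition, so the vertex set does not occur.\<close>

definition separation_dimension :: "'a set set \<Rightarrow> nat" where
  "separation_dimension E = (LEAST d. 0 < d \<and> (\<exists>f. separating_function E d f))"

text \<open>So the minimum defining the separation dimension is attained for every finite simple graph.\<close>

lemma separating_function_exists:
  assumes "finite_simple_graph V E"
  shows "\<exists>d>0. \<exists>f. separating_function E d f"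
proof -
  have "E \<subseteq> Pow V" "finite V"
    using assms by (auto simp: finite_simple_graph_def)
  then have "finite E"
    by (simp add: finite_subset[of E "Pow V"])
  then obtain n :: nat and h where E: "E = h ` {i. i < n}"
    using finite_imp_nat_seg_image_inj_on[of E] by metis
  define f :: "'a \<Rightarrow> nat \<Rightarrow> real" where "f v i = (if v \<in> h i then 0 else 1)" for v i
  have "\<exists>i<Suc n. \<exists>a. hyperplane_separates i a (f ` e) (f ` e')"
    if "e \<in> E" "e' \<in> E" "e \<inter> e' = {}" for e e'
  proof -
    from that(1) E obtain i where i: "i < n" "e = h i"
      by auto
    have "hyperplane_separates i (1/2) (f ` e) (f ` e')"
      using that(3) unfolding hyperplane_separates_def f_def i(2) by auto
    with i(1) show ?thesis
      by (intro exI[of _ i] conjI exI[of _ "1/2"]) simp_all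
  qed
  then have "separating_function E (Suc n) f"
    unfolding separating_function_def by blast
  then show ?thesis
    by (intro exI[of _ "Suc n"] conjI exI[of _ f]) simp_all
qed

end

theory Submission
  imports Defs "HOL-Library.Product_Lexorder"
begin

text \<open>
  Orient the edges so that, after reversing some of the three orders, every edge goes upwards in all
  of them; this costs a factor 4. For a path formed by edges \<open>(a, b')\<close>, \<open>(a, b)\<close>, \<open>(a', b)\<close> the outer
  edges can then only be separated by an order with \<open>b' < a'\<close>. Delete, at every head, the edge from
  the lowest tail in the first order. Among the edges that are left, delete at every tail \<open>a\<close> the edge
  to the head \<open>q a\<close> that is highest in the first order, and at every head the edges from the lowest
  tails in the second and in the third order. If \<open>(a, b)\<close> were still there, the path condition would
  put \<open>q a\<close> below \<open>b\<close> in the second and third order, and then the edge \<open>(a, b)\<close> and the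
  first deleted edge at \<open>q a\<close> would not be separated. So there are at most \<open>4 * n\<close> edges.
\<close>

lemma finite_ex_max_successor:
  fixes k :: "'a \<Rightarrow> 'o::linorder"
  assumes "finite D"
  obtains q where "\<And>a b. (a, b) \<in> D \<Longrightarrow> (a, q a) \<in> D \<and> k b \<le> k (q a)"
proof -
  have "\<exists>m. \<forall>b. (a, b) \<in> D \<longrightarrow> (a, m) \<in> D \<and> k b \<le> k m" for a
  proof (cases "D `` {a} = {}")
    case False
    have fin: "finite (k ` (D `` {a}))"
      using assms by (simp add: finite_Image)
    with False have "Max (k ` (D `` {a})) \<in> k ` (D `` {a})"
      by (intro Max_in) auto
    then obtain m where "m \<in> D `` {a}" "Max (k ` (D `` {a})) = k m"
      by blast
    then show ?thesis
      using fin by (metis Image_singleton_iff Max_ge imageI)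
  qed auto
  then show thesis
    using that by metis
qed

lemma finite_ex_min_predecessor:
  fixes k :: "'a \<Rightarrow> 'o::linorder"
  assumes "finite D"
  obtains p where "\<And>a b. (a, b) \<in> D \<Longrightarrow> (p b, b) \<in> D \<and> k (p b) \<le> k a"
proof -
  have "\<exists>m. \<forall>a. (a, b) \<in> D \<longrightarrow> (m, b) \<in> D \<and> k m \<le> k a" for b
  proof (cases "D\<inverse> `` {b} = {}")
    case False
    have fin: "finite (k ` (D\<inverse> `` {b}))"
      using assms by (simp add: finite_Image)
    with False have "Min (k ` (D\<inverse> `` {b})) \<in> k ` (D\<inverse> `` {b})"
      by (intro Min_in) auto
    then obtain m where "m \<in> D\<inverse> `` {b}" "Min (k ` (D\<inverse> `` {b})) = k m"
      by blast
    then show ?thesis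
      using fin by (metis Image_singleton_iff Min_le converse_iff imageI)
  qed auto
  then show thesis
    using that by metis
qed

text \<open>Since edges go upwards, comparing the head of one edge with the tail of the other
  decides whether an order in \<open>{x, y, z}\<close> separates them.\<close>

lemma card_upward_edges_le:
  fixes x y z :: "'a \<Rightarrow> 'o::linorder"
  assumes V: "finite V" "D \<subseteq> V \<times> V"
    and up: "\<And>a b. (a, b) \<in> D \<Longrightarrow> x a < x b \<and> y a < y b \<and> z a < z b"
    and sep: "\<And>a b c d. (a, b) \<in> D \<Longrightarrow> (c, d) \<in> D \<Longrightarrow> {a, b} \<inter> {c, d} = {} \<Longrightarrow>
      \<exists>k\<in>{x, y, z}. k b < k c \<or> k d < k a"
  shows "card D \<le> 4 * card V"
proof -
  have path: "x b' < x a' \<or> y b' < y a' \<or> z b' < z a'"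
    if "(a, b') \<in> D" "(a, b) \<in> D" "(a', b) \<in> D" "a \<noteq> a'" "b \<noteq> b'" "a' \<noteq> b'" for a b a' b'
  proof -
    have "a \<noteq> b"
      using up[OF that(2)] by auto
    then have "\<exists>k\<in>{x, y, z}. k b' < k a' \<or> k b < k a"
      using that by (intro sep) auto
    \<comment> \<open>The alternative \<open>k b < k a\<close> contradicts the upward middle edge
      \<open>(a, b)\<close>.\<close>
    then show ?thesis
      using up[OF that(2)] by fastforce
  qed
  have fin: "finite D"
    using V finite_subset by blast
  obtain p where p: "\<And>a b. (a, b) \<in> D \<Longrightarrow> (p b, b) \<in> D \<and> x (p b) \<le> x a"
    using finite_ex_min_predecessor[OF fin] by blast
  define D1 where "D1 = {(a, b) \<in> D. a \<noteq> p b}"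
  have "finite D1" "D1 \<subseteq> D"
    using fin by (auto simp: D1_def intro: finite_subset[OF _ fin])
  obtain q where q: "\<And>a b. (a, b) \<in> D1 \<Longrightarrow> (a, q a) \<in> D1 \<and> x b \<le> x (q a)"
    using finite_ex_max_successor[OF \<open>finite D1\<close>] by blast
  obtain r where r: "\<And>a b. (a, b) \<in> D1 \<Longrightarrow> (r b, b) \<in> D1 \<and> y (r b) \<le> y a"
    using finite_ex_min_predecessor[OF \<open>finite D1\<close>] by blast
  obtain s where s: "\<And>a b. (a, b) \<in> D1 \<Longrightarrow> (s b, b) \<in> D1 \<and> z (s b) \<le> z a"
    using finite_ex_min_predecessor[OF \<open>finite D1\<close>] by blast
  have deleted: "b = q a \<or> a = r b \<or> a = s b" if "(a, b) \<in> D1" for a b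
  proof (rule ccontr)
    assume "\<not> ?thesis"
    then have ne: "b \<noteq> q a" "a \<noteq> r b" "a \<noteq> s b"
      by auto
    have D: "(a, b) \<in> D" "(a, q a) \<in> D" "(r b, b) \<in> D" "(s b, b) \<in> D"
      using q[OF that] r[OF that] s[OF that] that \<open>D1 \<subseteq> D\<close> by auto
    note le = q[OF that, THEN conjunct2] r[OF that, THEN conjunct2] s[OF that, THEN conjunct2]
    note lt = D[THEN up]
    \<comment> \<open>Both tails lie below \<open>b\<close> in \<open>x\<close>, and
      \<open>x b \<le> x (q a)\<close>.\<close>
    have "r b \<noteq> q a" "s b \<noteq> q a"
      using le(1) lt(3,4) by force+
    \<comment> \<open>For \<open>r b\<close>, \<open>path\<close> cannot hold through
      \<open>x\<close>, by the same chain, nor through \<open>y\<close>, as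
      \<open>y (r b) \<le> y a < y (q a)\<close>; only \<open>z\<close> remains. For
      \<open>s b\<close>, \<open>y\<close> and \<open>z\<close> swap roles.\<close>
    then have "z (q a) < z (r b)" "y (q a) < y (s b)"
      using path[OF D(2,1,3)] path[OF D(2,1,4)] ne le lt by force+
    then have below: "y (q a) < y b" "z (q a) < z b"
      using lt(3,4) by auto
    let ?c = "p (q a)"
    \<comment> \<open>\<open>a \<noteq> ?c\<close> because \<open>(a, q a)\<close> survived the
      first deletion.\<close>
    have c: "(?c, q a) \<in> D" "x ?c \<le> x a" "a \<noteq> ?c"
      using p[OF D(2)] q[OF that] by (auto simp: D1_def)
    have "?c \<noteq> b"
      using c(2) lt(1) by auto
    then have "x b < x ?c \<or> y b < y ?c \<or> z b < z ?c"
      using path[OF D(1,2) c(1)] c(3) ne by auto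
    \<comment> \<open>\<open>x ?c \<le> x a < x b\<close> excludes \<open>x\<close>; in
      \<open>y\<close> and \<open>z\<close>, \<open>?c\<close> is below \<open>q a\<close>, hence
      below \<open>b\<close>.\<close>
    then show False
      using c(2) lt(1) below up[OF c(1)] by auto
  qed
  have "D \<subseteq> (\<lambda>b. (p b, b)) ` V \<union> (\<lambda>a. (a, q a)) ` V \<union> (\<lambda>b. (r b, b)) ` V \<union> (\<lambda>b. (s b, b)) ` V"
    (is "D \<subseteq> ?P \<union> ?Q \<union> ?R \<union> ?S")
  proof (rule subsetI, clarify)
    fix a b
    assume ab: "(a, b) \<in> D" "(a, b) \<notin> ?S" "(a, b) \<notin> ?R" "(a, b) \<notin> ?Q"
    moreover from ab(1) V have "a \<in> V" "b \<in> V"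
      by auto
    ultimately show "(a, b) \<in> ?P"
      using deleted[of a b] by (auto simp: D1_def)
  qed
  then have "card D \<le> card (?P \<union> ?Q \<union> ?R \<union> ?S)"
    using V(1) by (intro card_mono) auto
  also have "\<dots> \<le> card ?P + card ?Q + card ?R + card ?S"
    by (meson add_mono card_Un_le order_refl order_trans)
  also have "\<dots> \<le> card V + card V + card V + card V"
    using V(1) by (intro add_mono card_image_le)
  finally show ?thesis
    by simp
qed

text \<open>Naming the lower endpoint in order 0 first orients each edge; the signs \<open>s\<close>
  and \<open>t\<close> for the other two orders give four classes of at most
  \<open>4 * card V\<close> edges each.\<close>

lemma card_edges_le_of_separating_function_3:
  assumes G: "finite_simple_graph V E" and f: "separating_function E 3 f"
  shows "card E \<le> 16 * card V"
proof -
  have V: "finite V" and E: "\<And>e. e \<in> E \<Longrightarrow> e \<subseteq> V \<and> card e = 2"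
    using G by (auto simp: finite_simple_graph_def)
  obtain r :: "'a \<Rightarrow> nat" where r: "inj_on r V"
    using V finite_imp_inj_to_nat_seg by blast
  \<comment> \<open>The second component breaks ties, so that every edge is strictly directed in each order.\<close>
  define g where "g s i v = (if s then (f v i, real (r v)) else (- f v i, - real (r v)))" for s :: bool and i v
  define D where "D s t =
    {(a, b). {a, b} \<in> E \<and> g True 0 a < g True 0 b \<and> g s 1 a < g s 1 b \<and> g t 2 a < g t 2 b}" for s t
  have DV: "D s t \<subseteq> V \<times> V" for s t
    using E by (auto simp: D_def)
  have D: "card (D s t) \<le> 4 * card V" for s t
  proof (rule card_upward_edges_le[OF V DV, where x = "g True 0" and y = "g s 1" and z = "g t 2"])
    fix a b c d
    assume "(a, b) \<in> D s t" "(c, d) \<in> D s t" "{a, b} \<inter> {c, d} = {}"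
    then obtain i h where "i < 3" and h: "hyperplane_separates i h (f ` {a, b}) (f ` {c, d})"
      using f unfolding separating_function_def D_def by blast
    \<comment> \<open>Separation is strict in the first component, so the tie-breaker is irrelevant;
      reversal only swaps the two alternatives.\<close>
    have "g u i b < g u i c \<or> g u i d < g u i a" for u
      using h by (cases u) (auto simp: hyperplane_separates_def g_def)
    moreover have "i = 0 \<or> i = 1 \<or> i = 2"
      using \<open>i < 3\<close> by auto
    ultimately show "\<exists>k\<in>{g True 0, g s 1, g t 2}. k b < k c \<or> k d < k a"
      by auto
  qed (simp add: D_def)
  have "E \<subseteq> (\<Union>(s, t)\<in>UNIV. (\<lambda>(a, b). {a, b}) ` D s t)"
  proof
    fix e
    assume "e \<in> E"
    with E obtain v w where e: "e = {v, w}" "v \<noteq> w" "v \<in> V" "w \<in> V"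
      by (metis card_2_iff insert_subset)
    have neq: "g u i v \<noteq> g u i w" for u i
      using r e by (auto simp: g_def inj_on_def)
    obtain a b where ab: "e = {a, b}" "g True 0 a < g True 0 b" "\<And>u i. g u i a \<noteq> g u i b"
      using neq e(1) by (metis insert_commute neq_iff)
    have "g True i a < g True i b \<or> g False i a < g False i b" for i
      using ab(3)[of True i] by (auto simp: g_def)
    then obtain s t where "g s 1 a < g s 1 b" "g t 2 a < g t 2 b"
      by blast
    with ab \<open>e \<in> E\<close> have "(a, b) \<in> D s t"
      by (simp add: D_def)
    with ab(1) show "e \<in> (\<Union>(s, t)\<in>UNIV. (\<lambda>(a, b). {a, b}) ` D s t)"
      by blast
  qed
  then have "card E \<le> card (\<Union>(s, t)\<in>UNIV. (\<lambda>(a, b). {a, b}) ` D s t)"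
    using V by (intro card_mono) (auto intro: finite_subset[OF DV])
  also have "\<dots> \<le> (\<Sum>st\<in>UNIV. card ((\<lambda>(a, b). {a, b}) ` D (fst st) (snd st)))"
    by (simp add: case_prod_beta card_UN_le)
  also have "\<dots> \<le> (\<Sum>st\<in>(UNIV :: (bool \<times> bool) set). 4 * card V)"
    using V by (intro sum_mono order_trans[OF card_image_le D]) (auto intro: finite_subset[OF DV])
  also have "\<dots> = 16 * card V"
    by (simp add: card_UNIV_bool flip: UNIV_Times_UNIV add: card_cartesian_product)
  finally show ?thesis .
qed

lemma sum_degree_eq:
  assumes "finite_simple_graph V E"
  shows "(\<Sum>v\<in>V. degree E v) = 2 * card E"
proof -
  have V: "finite V" and E: "\<And>e. e \<in> E \<Longrightarrow> e \<subseteq> V \<and> card e = 2"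
    using assms by (auto simp: finite_simple_graph_def)
  have "finite E"
    using V E by (intro finite_subset[of E "Pow V"]) auto
  moreover have "{v \<in> V. v \<in> e} = e" if "e \<in> E" for e
    using E[OF that] by auto
  ultimately show ?thesis
    using V E unfolding degree_def by (intro sum_multicount) auto
qed

theorem theorem2:
  shows "\<exists>c::real. \<forall>(V::'a set) E.
    finite_simple_graph V E \<and> separation_dimension E = 3 \<longrightarrow> average_degree V E \<le> c"
proof (intro exI allI impI, elim conjE)
  fix V :: "'a set" and E
  assume G: "finite_simple_graph V E" and "separation_dimension E = 3"
  \<comment> \<open>The \<open>LEAST\<close> is attained because some separating function
    exists.\<close>
  then obtain f where "separating_function E 3 f"
    using LeastI_ex[OF separating_function_exists[OF G]]
    by (auto simp: separation_dimension_def)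
  then have "(\<Sum>v\<in>V. degree E v) \<le> 32 * card V"
    using card_edges_le_of_separating_function_3[OF G] sum_degree_eq[OF G] by fastforce
  then have "(\<Sum>v\<in>V. real (degree E v)) \<le> 32 * real (card V)"
    by (simp flip: of_nat_sum)
  then show "average_degree V E \<le> 32"
    \<comment> \<open>Division by zero makes the average degree of the empty graph 0.\<close>
    by (cases "card V = 0") (simp_all add: average_degree_def divide_le_eq)
qed

end
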